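(* If $G$ is an $n$-vertex graph that does not contain $K_4$ as a subgraph, then $\pi_f(G)\le 3\left(1-\frac{12}{n^4}+O\!\left(\frac1{n^5}\right)\right)$.
   Context: Two edges are nonincident if they share no endpoint. A linear ordering of $V(G)$ separates a pair of nonincident edges if both endpoints of one edge precede both endpoints of the other. $\pi_t(G)$ is the minimum length of a list of linear orderings of $V(G)$ (repetitions allowed) separating every pair of nonincident edges at least $t$ times, and $\pi_f(G)=\liminf_{t\to\infty}\pi_t(G)/t$ (equivalently the minimum of $a/b$ over lists of $a$ orderings separating every nonincident pair at least $b$ times). *)

theory Defs
  imports Complex_Main "HOL-Library.Extended_Real" "HOL-Library.Liminf_Limsup"
    "HOL-Library.Landau_Symbols"
begin

definition simple_graph :: "'a set \<Rightarrow> 'a set set \<Rightarrow> bool" where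
  "simple_graph V E \<longleftrightarrow> finite V \<and> (\<forall>e\<in>E. e \<subseteq> V \<and> card e = 2)"

definition contains_complete :: "nat \<Rightarrow> 'a set \<Rightarrow> 'a set set \<Rightarrow> bool" where
  "contains_complete k V E \<longleftrightarrow>
     (\<exists>S. S \<subseteq> V \<and> finite S \<and> card S = k \<and> (\<forall>u\<in>S. \<forall>v\<in>S. u \<noteq> v \<longrightarrow> {u, v} \<in> E))"

definition nonincident :: "'a set \<Rightarrow> 'a set \<Rightarrow> bool" where
  "nonincident e f \<longleftrightarrow> e \<inter> f = {}"

text \<open>Linear orderings are the reflexive ones of the library's linear_order_on;
  removing the diagonal gives strict precedence.\<close>

definition all_precede :: "'a rel \<Rightarrow> 'a set \<Rightarrow> 'a set \<Rightarrow> bool" where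
  "all_precede r e f \<longleftrightarrow> (\<forall>u\<in>e. \<forall>v\<in>f. (u, v) \<in> r - Id)"

definition separates :: "'a rel \<Rightarrow> 'a set \<Rightarrow> 'a set \<Rightarrow> bool" where
  "separates r e f \<longleftrightarrow> all_precede r e f \<or> all_precede r f e"

definition separating_list :: "'a set \<Rightarrow> 'a set set \<Rightarrow> nat \<Rightarrow> 'a rel list \<Rightarrow> bool" where
  "separating_list V E t rs \<longleftrightarrow>
     (\<forall>r\<in>set rs. linear_order_on V r) \<and>
     (\<forall>e\<in>E. \<forall>f\<in>E. nonincident e f \<longrightarrow> t \<le> length (filter (\<lambda>r. separates r e f) rs))"

definition sep_dim :: "'a set \<Rightarrow> 'a set set \<Rightarrow> nat \<Rightarrow> nat" where
  "sep_dim V E t = (LEAST k. \<exists>rs. separating_list V E t rs \<and> length rs = k)"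

text \<open>The library's liminf needs a complete lattice, hence ereal. The term for
  t = 0 is a division by zero, which has no effect on the liminf.\<close>

definition frac_sep_dim :: "'a set \<Rightarrow> 'a set set \<Rightarrow> ereal" where
  "frac_sep_dim V E = liminf (\<lambda>t. ereal (real (sep_dim V E t) / real t))"

end

theory Submission
  imports Defs "HOL-Combinatorics.Permutations" "HOL-Real_Asymp.Real_Asymp"
begin

text \<open>
  In a uniformly random ordering of the vertices every pair of nonincident edges is separated
  with probability 1/3. Since there is no copy of $K_4$, the set $S$ of the first four vertices
  contains a nonadjacent pair, so at most two of the three pairings of $S$ have to be separated.
  Rearrange $S$ at random so that each of these two is separated with probability 1/2, while, for
  every edge $pq$ and vertex $r$ of $S$, the vertex $r$ is still the last of $p,q,r$ with
  probability at least 1/3. The latter is all that matters for an edge pair with three endpoints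
  in $S$; the separation of a pair with at most two endpoints in $S$ does not depend on the order
  inside $S$. Each 4-set comes first with probability $1/C$, where $C$ is the number of 4-sets,
  hence every pair is now separated with probability at least $1/3 + 1/(6C)$, and the reciprocal
  $3/(1 + 1/(2C))$ bounds the fractional separation dimension.
\<close>

section \<open>Orderings as position functions\<close>

text \<open>Orderings are handled as injective position functions, so that permuting the vertices is
  composition and separation is a comparison of numbers.\<close>

definition separates_by :: "('a \<Rightarrow> nat) \<Rightarrow> 'a \<Rightarrow> 'a \<Rightarrow> 'a \<Rightarrow> 'a \<Rightarrow> bool" where
  "separates_by f p q r s \<longleftrightarrow>
     f p < f r \<and> f p < f s \<and> f q < f r \<and> f q < f s \<or>
     f r < f p \<and> f r < f q \<and> f s < f p \<and> f s < f q"

definition position_order :: "'a set \<Rightarrow> ('a \<Rightarrow> nat) \<Rightarrow> 'a rel" where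
  "position_order V f = {(u, v). u \<in> V \<and> v \<in> V \<and> f u \<le> f v}"

lemma linear_order_on_position_order:
  assumes "inj_on f V"
  shows "linear_order_on V (position_order V f)"
  using assms
  unfolding linear_order_on_def partial_order_on_def preorder_on_def refl_on_def trans_def
    antisym_def total_on_def position_order_def inj_on_def
  by force

lemma separates_position_order:
  assumes "separates_by f p q r s" "{p, q, r, s} \<subseteq> V"
  shows "separates (position_order V f) {p, q} {r, s}"
  using assms
  unfolding separates_by_def separates_def all_precede_def position_order_def by auto

section \<open>From finite families of orderings to the fractional dimension\<close>

text \<open>Concatenating \<open>m\<close> copies of the list multiplies its length and all
  separation counts by \<open>m\<close>. This bounds the quotient at the multiples of
  \<open>b\<close>, and a liminf is at most the liminf along a subsequence.\<close>

lemma frac_sep_dim_le_of_separating_list: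
  assumes "separating_list V E b rs" "b > 0"
  shows "frac_sep_dim V E \<le> ereal (real (length rs) / real b)"
proof -
  let ?f = "\<lambda>t. ereal (real (sep_dim V E t) / real t)"
  have "sep_dim V E (b * m) \<le> length rs * m" for m
  proof -
    let ?rs = "concat (replicate m rs)"
    have len: "length (filter P ?rs) = m * length (filter P rs)" for P
      by (induction m) auto
    have "set ?rs \<subseteq> set rs" by (induction m) auto
    then have "separating_list V E (b * m) ?rs"
      using assms(1) unfolding separating_list_def by (auto simp: len mult.commute)
    moreover have "length ?rs = length rs * m"
      using len[of "\<lambda>_. True"] by simp
    ultimately show ?thesis
      unfolding sep_dim_def by (intro Least_le) blast
  qed
  \<comment> \<open>\<open>Suc m\<close> instead of \<open>m\<close> keeps the divisor
    positive.\<close>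
  then have le: "?f (b * Suc m) \<le> ereal (real (length rs) / real b)" for m
    using \<open>b > 0\<close>
    by (simp add: field_simps flip: of_nat_mult of_nat_Suc del: mult_Suc mult_Suc_right)
       (metis mult.commute)
  have "strict_mono (\<lambda>m. b * Suc m)"
    using \<open>b > 0\<close> by (intro strict_monoI) simp
  then have "liminf ?f \<le> liminf (?f \<circ> (\<lambda>m. b * Suc m))"
    by (rule liminf_subseq_mono)
  also have "\<dots> \<le> liminf (\<lambda>m::nat. ereal (real (length rs) / real b))"
    using le by (intro Liminf_mono always_eventually allI) (simp only: o_def)
  also have "\<dots> = ereal (real (length rs) / real b)"
    by (simp add: Liminf_const)
  finally show ?thesis unfolding frac_sep_dim_def .
qed

text \<open>Indexing preserves multiplicities: several indices may yield the same ordering, which a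
  set of orderings would count only once.\<close>

lemma frac_sep_dim_le_of_family:
  assumes "finite I" "b > 0"
    and "\<And>i. i \<in> I \<Longrightarrow> linear_order_on V (r i)"
    and "\<And>e f. e \<in> E \<Longrightarrow> f \<in> E \<Longrightarrow> nonincident e f \<Longrightarrow> b \<le> card {i \<in> I. separates (r i) e f}"
  shows "frac_sep_dim V E \<le> ereal (real (card I) / real b)"
proof -
  obtain xs where xs: "set xs = I" "distinct xs"
    using \<open>finite I\<close> finite_distinct_list by blast
  have "length (filter (\<lambda>r. separates r e f) (map r xs)) = card {i \<in> I. separates (r i) e f}" for e f
    using distinct_card[OF distinct_filter[OF xs(2)], of "\<lambda>i. separates (r i) e f"] xs(1)
    by (simp add: filter_map o_def)
  then have "separating_list V E b (map r xs)"
    using assms(3,4) xs unfolding separating_list_def by auto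
  from frac_sep_dim_le_of_separating_list[OF this \<open>b > 0\<close>] show ?thesis
    using distinct_card[OF xs(2)] xs(1) by simp
qed

section \<open>Symmetry of the three pairings of four vertices\<close>

text \<open>The two vertices with the smallest positions form one side of a pairing, and that
  pairing is separated.\<close>

lemma separates_by_cases:
  assumes "f p \<noteq> f q" "f p \<noteq> f r" "f p \<noteq> f s" "f q \<noteq> f r" "f q \<noteq> f s" "f r \<noteq> f s"
  shows "separates_by f p q r s \<or> separates_by f p r q s \<or> separates_by f r q p s"
  using assms unfolding separates_by_def by (elim linorder_neqE_nat) simp_all

text \<open>Each permutation in \<open>J\<close> separates exactly one of the three pairings, and
  the two transpositions carry those separating pq|rs bijectively to those separating pr|qs and
  rq|ps. With \<open>J\<close> an arbitrary set closed under both, this also covers events that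
  treat p, q, r alike but single out s.\<close>

lemma card_separating_third:
  fixes h :: "'a \<Rightarrow> nat"
  assumes "finite V" "inj_on h V" "distinct [p, q, r, s]" "{p, q, r, s} \<subseteq> V"
    and J: "J \<subseteq> {\<pi>. \<pi> permutes V}"
    and closed_qr: "\<And>\<pi>. \<pi> \<in> J \<Longrightarrow> \<pi> \<circ> transpose q r \<in> J"
    and closed_pr: "\<And>\<pi>. \<pi> \<in> J \<Longrightarrow> \<pi> \<circ> transpose p r \<in> J"
  shows "3 * card {\<pi> \<in> J. separates_by (h \<circ> \<pi>) p q r s} = card J"
proof -
  define A where "A = {\<pi> \<in> J. separates_by (h \<circ> \<pi>) p q r s}"
  define B where "B = {\<pi> \<in> J. separates_by (h \<circ> \<pi>) p r q s}"
  define C where "C = {\<pi> \<in> J. separates_by (h \<circ> \<pi>) r q p s}"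
  have fin: "finite J"
    using J finite_permutations[OF \<open>finite V\<close>] by (rule finite_subset)
  have involution: "\<pi> \<circ> transpose x y \<circ> transpose x y = \<pi>" for \<pi> :: "'a \<Rightarrow> 'a" and x y
    by (simp add: o_assoc[symmetric])
  have dist: "p \<noteq> q" "p \<noteq> r" "q \<noteq> r" "s \<noteq> p" "s \<noteq> q" "s \<noteq> r"
    using assms(3) by auto
  have sep_qr: "separates_by (h \<circ> (\<pi> \<circ> transpose q r)) p r q s = separates_by (h \<circ> \<pi>) p q r s"
    "separates_by (h \<circ> (\<pi> \<circ> transpose q r)) p q r s = separates_by (h \<circ> \<pi>) p r q s" for \<pi>
    using dist by (simp_all add: separates_by_def)
  have sep_pr: "separates_by (h \<circ> (\<pi> \<circ> transpose p r)) r q p s = separates_by (h \<circ> \<pi>) p q r s"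
    "separates_by (h \<circ> (\<pi> \<circ> transpose p r)) p q r s = separates_by (h \<circ> \<pi>) r q p s" for \<pi>
    using dist by (simp_all add: separates_by_def)
  have "bij_betw (\<lambda>\<pi>. \<pi> \<circ> transpose q r) A B"
    by (rule bij_betw_byWitness[where f' = "\<lambda>\<pi>. \<pi> \<circ> transpose q r"])
       (auto simp: A_def B_def sep_qr involution closed_qr)
  then have AB: "card A = card B" by (rule bij_betw_same_card)
  have "bij_betw (\<lambda>\<pi>. \<pi> \<circ> transpose p r) A C"
    by (rule bij_betw_byWitness[where f' = "\<lambda>\<pi>. \<pi> \<circ> transpose p r"])
       (auto simp: A_def C_def sep_pr involution closed_pr)
  then have AC: "card A = card C" by (rule bij_betw_same_card)
  have "separates_by (h \<circ> \<pi>) p q r s \<or> separates_by (h \<circ> \<pi>) p r q s \<or> separates_by (h \<circ> \<pi>) r q p s"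
    if "\<pi> \<in> J" for \<pi>
  proof -
    have \<pi>: "\<pi> permutes V" using J that by auto
    then have "inj_on (h \<circ> \<pi>) V"
      using \<open>inj_on h V\<close> by (simp add: comp_inj_on permutes_inj_on permutes_image)
    then have "(h \<circ> \<pi>) x \<noteq> (h \<circ> \<pi>) y" if "x \<in> {p, q, r, s}" "y \<in> {p, q, r, s}" "x \<noteq> y" for x y
      using that assms(4) by (meson inj_onD subsetD)
    then have "(h \<circ> \<pi>) p \<noteq> (h \<circ> \<pi>) q" "(h \<circ> \<pi>) p \<noteq> (h \<circ> \<pi>) r" "(h \<circ> \<pi>) p \<noteq> (h \<circ> \<pi>) s"
      "(h \<circ> \<pi>) q \<noteq> (h \<circ> \<pi>) r" "(h \<circ> \<pi>) q \<noteq> (h \<circ> \<pi>) s" "(h \<circ> \<pi>) r \<noteq> (h \<circ> \<pi>) s"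
      using assms(3) by auto
    then show ?thesis by (rule separates_by_cases)
  qed
  then have "J = A \<union> (B \<union> C)" unfolding A_def B_def C_def by auto
  moreover have "B \<inter> C = {}" "A \<inter> (B \<union> C) = {}"
    unfolding A_def B_def C_def separates_by_def by auto
  moreover have "finite A" "finite B" "finite C"
    using fin unfolding A_def B_def C_def by auto
  ultimately have "card J = card A + (card B + card C)"
    by (simp add: card_Un_disjoint)
  then show ?thesis using AB AC unfolding A_def by simp
qed

section \<open>Each set of a given size comes first equally often\<close>

lemma ex_permutes_image_eq:
  assumes "finite V" "S \<subseteq> V" "T \<subseteq> V" "card S = card T"
  obtains \<sigma> where "\<sigma> permutes V" "\<sigma> ` S = T"
proof -
  have fin: "finite S" "finite T" using assms finite_subset by blast+
  obtain \<alpha> where \<alpha>: "bij_betw \<alpha> S T"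
    using finite_same_card_bij[OF fin \<open>card S = card T\<close>] by blast
  have "card (V - S) = card (V - T)"
    using assms fin by (simp add: card_Diff_subset)
  then obtain \<beta> where \<beta>: "bij_betw \<beta> (V - S) (V - T)"
    using finite_same_card_bij[of "V - S" "V - T"] \<open>finite V\<close> by blast
  define \<sigma> where "\<sigma> v = (if v \<in> S then \<alpha> v else if v \<in> V then \<beta> v else v)" for v
  have "bij_betw \<sigma> S T" using \<alpha> by (simp add: \<sigma>_def cong: bij_betw_cong)
  moreover have "bij_betw \<sigma> (V - S) (V - T)"
    using \<beta> by (subst bij_betw_cong[where g = \<beta>]) (auto simp: \<sigma>_def)
  ultimately have "bij_betw \<sigma> (S \<union> (V - S)) (T \<union> (V - T))"
    by (rule bij_betw_combine) auto
  then have "bij_betw \<sigma> V V" using assms by (simp add: Un_absorb1)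
  then have "\<sigma> permutes V"
    using \<open>S \<subseteq> V\<close> by (intro bij_imp_permutes) (auto simp: \<sigma>_def)
  moreover have "\<sigma> ` S = T" using \<open>bij_betw \<sigma> S T\<close> by (rule bij_betw_imp_surj_on)
  ultimately show ?thesis using that by blast
qed

text \<open>Each permutation maps exactly one set of the size of \<open>T\<close> onto
  \<open>F\<close>, namely the preimage of \<open>F\<close>. Precomposition with the inverse of a
  permutation taking \<open>S\<close> to \<open>T\<close> shows that \<open>S\<close> and
  \<open>T\<close> are this preimage equally often.\<close>

lemma binomial_mult_card_permutes_image_eq:
  assumes "finite V" "T \<subseteq> V" "F \<subseteq> V" "card F = card T"
  shows "(card V choose card T) * card {\<pi>. \<pi> permutes V \<and> \<pi> ` T = F} = card {\<pi>. \<pi> permutes V}"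
proof -
  define M where "M S = {\<pi>. \<pi> permutes V \<and> \<pi> ` S = F}" for S
  define \<S> where "\<S> = {S. S \<subseteq> V \<and> card S = card T}"
  have fin: "finite (M S)" for S
    using finite_permutations[OF \<open>finite V\<close>] by (rule finite_subset[rotated]) (auto simp: M_def)
  have "card (M S) = card (M T)" if "S \<in> \<S>" for S
  proof -
    obtain \<sigma> where \<sigma>: "\<sigma> permutes V" "\<sigma> ` S = T"
      using ex_permutes_image_eq[OF \<open>finite V\<close> _ \<open>T \<subseteq> V\<close>, of S] \<open>S \<in> \<S>\<close> unfolding \<S>_def by blast
    have inv: "inv \<sigma> ` T = S"
      using \<sigma> by (metis image_inv_f_f permutes_inj)
    have "bij_betw (\<lambda>\<pi>. \<pi> \<circ> inv \<sigma>) (M S) (M T)"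
    proof (rule bij_betw_byWitness[where f' = "\<lambda>\<pi>. \<pi> \<circ> \<sigma>"])
      show "\<forall>\<pi>\<in>M S. \<pi> \<circ> inv \<sigma> \<circ> \<sigma> = \<pi>" "\<forall>\<pi>\<in>M T. \<pi> \<circ> \<sigma> \<circ> inv \<sigma> = \<pi>"
        using permutes_inv_o[OF \<sigma>(1)] by (simp_all add: o_assoc[symmetric])
      show "(\<lambda>\<pi>. \<pi> \<circ> inv \<sigma>) ` M S \<subseteq> M T" "(\<lambda>\<pi>. \<pi> \<circ> \<sigma>) ` M T \<subseteq> M S"
        using permutes_compose[OF \<sigma>(1)] permutes_compose[OF permutes_inv[OF \<sigma>(1)]] \<sigma>(2) inv
        by (auto simp only: M_def image_subset_iff mem_Collect_eq image_comp[symmetric])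
    qed
    then show ?thesis by (rule bij_betw_same_card)
  qed
  then have "(\<Sum>S\<in>\<S>. card (M S)) = card \<S> * card (M T)" by simp
  moreover have "(\<Sum>S\<in>\<S>. card (M S)) = card (\<Union>S\<in>\<S>. M S)"
  proof (rule card_UN_disjoint[symmetric])
    show "finite \<S>" using \<open>finite V\<close> by (simp add: \<S>_def)
    show "\<forall>S\<in>\<S>. finite (M S)" using fin by blast
    show "\<forall>S\<in>\<S>. \<forall>S'\<in>\<S>. S \<noteq> S' \<longrightarrow> M S \<inter> M S' = {}"
      unfolding M_def using permutes_inj by (auto dest!: permutes_inj simp: inj_image_eq_iff)
  qed
  moreover have "(\<Union>S\<in>\<S>. M S) = {\<pi>. \<pi> permutes V}"
  proof (intro equalityI subsetI)
    fix \<pi> assume "\<pi> \<in> {\<pi>. \<pi> permutes V}"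
    then have \<pi>: "\<pi> permutes V" by simp
    have "inv \<pi> ` F \<subseteq> V"
      using permutes_image[OF permutes_inv[OF \<pi>]] \<open>F \<subseteq> V\<close> by blast
    moreover have "card (inv \<pi> ` F) = card T"
      using permutes_inj[OF permutes_inv[OF \<pi>]] \<open>card F = card T\<close>
      by (simp add: card_image inj_on_subset)
    moreover have "\<pi> ` inv \<pi> ` F = F"
      using \<pi> by (simp add: image_f_inv_f permutes_surj)
    ultimately show "\<pi> \<in> (\<Union>S\<in>\<S>. M S)"
      using \<pi> unfolding M_def \<S>_def by blast
  qed (auto simp: M_def)
  moreover have "card \<S> = (card V choose card T)"
    using \<open>finite V\<close> unfolding \<S>_def by (rule n_subsets)
  ultimately show ?thesis unfolding M_def by simp
qed

section \<open>Six orders of a 4-set with a nonadjacent pair\<close>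

text \<open>The random order of \<open>S\<close> is uniform on six listed orders, so the thresholds
  3 and 2 stand for the probabilities 1/2 and 1/3.\<close>

definition good_positions :: "'a set set \<Rightarrow> 'a set \<Rightarrow> (nat \<Rightarrow> 'a \<Rightarrow> nat) \<Rightarrow> bool" where
  "good_positions E S pos \<longleftrightarrow>
     (\<forall>k<6. inj_on (pos k) S \<and> pos k ` S \<subseteq> {..<4}) \<and>
     (\<forall>p\<in>S. \<forall>q\<in>S. \<forall>r\<in>S. \<forall>s\<in>S. distinct [p, q, r, s] \<longrightarrow> {p, q} \<in> E \<longrightarrow> {r, s} \<in> E \<longrightarrow>
        3 \<le> (\<Sum>k<6. of_bool (separates_by (pos k) p q r s) :: nat)) \<and>
     (\<forall>p\<in>S. \<forall>q\<in>S. \<forall>r\<in>S. distinct [p, q, r] \<longrightarrow> {p, q} \<in> E \<longrightarrow>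
        2 \<le> (\<Sum>k<6. of_bool (pos k p < pos k r \<and> pos k q < pos k r) :: nat))"

text \<open>The pairing uv|bc need not be separated, so three of the six orders go to ub|cv and
  three to uc|bv. Vertex b is the last of u, v, b in only one order, and likewise c of u, v, c; this
  is harmless because uv is not an edge.\<close>

lemma ex_good_positions:
  assumes "card S = 4" "u \<in> S" "v \<in> S" "u \<noteq> v" "{u, v} \<notin> E"
  shows "\<exists>pos. good_positions E S pos"
proof -
  have "finite S" using assms(1) by (metis card.infinite zero_neq_numeral)
  then have "card (S - {u, v}) = 2"
    using assms by (simp add: card_Diff_subset)
  then obtain b c where bc: "S - {u, v} = {b, c}" "b \<noteq> c"
    by (auto simp: card_2_iff)
  then have S: "S = {u, b, c, v}" and dist: "u \<noteq> b" "u \<noteq> c" "b \<noteq> c" "v \<noteq> b" "v \<noteq> c" "u \<noteq> v"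
    using assms by auto
  have nE: "{u, v} \<notin> E" "{v, u} \<notin> E"
    using assms by (auto simp: insert_commute)
  (* In each row the k-th entry is the position in the k-th of the orders
     u b c v, c v u b, c v b u, u c b v, b v u c, b v c u. *)
  define pos :: "nat \<Rightarrow> 'a \<Rightarrow> nat" where
    "pos k x = (if x = u then [0, 2, 3, 0, 2, 3] else if x = b then [1, 3, 2, 2, 0, 0]
       else if x = c then [2, 0, 0, 1, 3, 2] else [3, 1, 1, 3, 1, 1]) ! k" for k x
  have all6: "(\<forall>k<6. P k) \<longleftrightarrow> P 0 \<and> P 1 \<and> P 2 \<and> P 3 \<and> P 4 \<and> P 5" for P :: "nat \<Rightarrow> bool"
    by (auto simp: numeral_eq_Suc All_less_Suc)
  have sum6: "(\<Sum>k<6. g k) = g 0 + g 1 + g 2 + g 3 + g 4 + g 5" for g :: "nat \<Rightarrow> nat"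
    by (simp add: numeral_eq_Suc)
  have pos [simp]:
    "pos k u = [0, 2, 3, 0, 2, 3] ! k" "pos k b = [1, 3, 2, 2, 0, 0] ! k"
    "pos k c = [2, 0, 0, 1, 3, 2] ! k" "pos k v = [3, 1, 1, 3, 1, 1] ! k" for k
    using dist by (simp_all add: pos_def)
  have "\<forall>k<6. inj_on (pos k) S \<and> pos k ` S \<subseteq> {..<4}"
    unfolding all6 S using dist dist[symmetric] by simp
  moreover have "3 \<le> (\<Sum>k<6. of_bool (separates_by (pos k) p q r s) :: nat)"
    if "p \<in> S" "q \<in> S" "r \<in> S" "s \<in> S" "distinct [p, q, r, s]" "{p, q} \<in> E" "{r, s} \<in> E" for p q r s
  proof -
    \<comment> \<open>What remains is a finite check of the table, with the cases that have uv as an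
      edge excluded.\<close>
    have "p \<in> {u, b, c, v}" "q \<in> {u, b, c, v}" "r \<in> {u, b, c, v}" "s \<in> {u, b, c, v}"
      "p \<noteq> q" "p \<noteq> r" "p \<noteq> s" "q \<noteq> r" "q \<noteq> s" "r \<noteq> s"
      "\<not> (p = u \<and> q = v)" "\<not> (p = v \<and> q = u)" "\<not> (r = u \<and> s = v)" "\<not> (r = v \<and> s = u)"
      using that S nE by auto
    then show ?thesis
      unfolding sum6 separates_by_def by (elim insertE emptyE; hypsubst) simp_all
  qed
  moreover have "2 \<le> (\<Sum>k<6. of_bool (pos k p < pos k r \<and> pos k q < pos k r) :: nat)"
    if "p \<in> S" "q \<in> S" "r \<in> S" "distinct [p, q, r]" "{p, q} \<in> E" for p q r
  proof -
    have "p \<in> {u, b, c, v}" "q \<in> {u, b, c, v}" "r \<in> {u, b, c, v}"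
      "p \<noteq> q" "p \<noteq> r" "q \<noteq> r" "\<not> (p = u \<and> q = v)" "\<not> (p = v \<and> q = u)"
      using that S nE by auto
    then show ?thesis
      unfolding sum6 by (elim insertE emptyE; hypsubst) simp_all
  qed
  ultimately show ?thesis unfolding good_positions_def by blast
qed

lemma good_positionsD:
  assumes "good_positions E S pos"
  shows "\<And>k. k < 6 \<Longrightarrow> inj_on (pos k) S"
    and "\<And>k x. k < 6 \<Longrightarrow> x \<in> S \<Longrightarrow> pos k x < 4"
    and "\<And>p q r s. {p, q, r, s} \<subseteq> S \<Longrightarrow> distinct [p, q, r, s] \<Longrightarrow> {p, q} \<in> E \<Longrightarrow> {r, s} \<in> E \<Longrightarrow>
        3 \<le> (\<Sum>k<6. of_bool (separates_by (pos k) p q r s) :: nat)"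
    and "\<And>p q r. {p, q, r} \<subseteq> S \<Longrightarrow> distinct [p, q, r] \<Longrightarrow> {p, q} \<in> E \<Longrightarrow>
        2 \<le> (\<Sum>k<6. of_bool (pos k p < pos k r \<and> pos k q < pos k r) :: nat)"
  using assms unfolding good_positions_def by (blast, blast, simp, simp)

section \<open>Rearranging the first four vertices\<close>

text \<open>Positions start at 0, so the first four vertices are those of position below 4.\<close>

definition rearranged :: "('a set \<Rightarrow> nat \<Rightarrow> 'a \<Rightarrow> nat) \<Rightarrow> 'a set \<Rightarrow> ('a \<Rightarrow> nat) \<Rightarrow> nat \<Rightarrow> 'a \<Rightarrow> nat" where
  "rearranged pos V f k x = (if f x < 4 then pos {y \<in> V. f y < 4} k x else f x)"

text \<open>This is six times the separation probability after rearrangement, for a fixed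
  \<open>f\<close>; the value 2 thus corresponds to 1/3.\<close>

definition rearranged_count ::
  "('a set \<Rightarrow> nat \<Rightarrow> 'a \<Rightarrow> nat) \<Rightarrow> 'a set \<Rightarrow> ('a \<Rightarrow> nat) \<Rightarrow> 'a \<Rightarrow> 'a \<Rightarrow> 'a \<Rightarrow> 'a \<Rightarrow> nat" where
  "rearranged_count pos V f p q r s = (\<Sum>k<6. of_bool (separates_by (rearranged pos V f k) p q r s))"

lemma separates_by_commute:
  "separates_by f p q s r = separates_by f p q r s"
  "separates_by f r s p q = separates_by f p q r s"
  unfolding separates_by_def by auto

text \<open>These symmetries bring a single endpoint outside the first four into the last
  argument.\<close>

lemma rearranged_count_commute:
  "rearranged_count pos V f p q s r = rearranged_count pos V f p q r s"
  "rearranged_count pos V f r s p q = rearranged_count pos V f p q r s"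
  unfolding rearranged_count_def
  by (simp_all add: separates_by_commute(1)[of _ p q] separates_by_commute(2)[of _ r s])

text \<open>The new positions inside the first four are distinct and stay below 4, so they cannot
  collide with the unchanged ones.\<close>

lemma inj_on_rearranged:
  assumes "inj_on f V" "good_positions E {y \<in> V. f y < 4} (pos {y \<in> V. f y < 4})" "k < 6"
  shows "inj_on (rearranged pos V f k) V"
proof (rule inj_onI)
  fix x y assume xy: "x \<in> V" "y \<in> V" "rearranged pos V f k x = rearranged pos V f k y"
  note inj = good_positionsD(1)[OF assms(2,3)] and lt = good_positionsD(2)[OF assms(2,3)]
  show "x = y"
  proof (cases "f x < 4"; cases "f y < 4")
    assume "f x < 4" "f y < 4"
    then show ?thesis using xy inj by (auto simp: rearranged_def dest: inj_onD)
  next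
    assume "f x < 4" "\<not> f y < 4"
    then show ?thesis using xy lt[of x] by (simp add: rearranged_def)
  next
    assume "\<not> f x < 4" "f y < 4"
    then show ?thesis using xy lt[of y] by (simp add: rearranged_def)
  next
    assume "\<not> f x < 4" "\<not> f y < 4"
    then show ?thesis using xy assms(1) by (simp add: rearranged_def inj_on_eq_iff)
  qed
qed

text \<open>This is the only case with a gain: 1/2 instead of 1/3.\<close>

lemma rearranged_count_ge_3:
  assumes "good_positions E {y \<in> V. f y < 4} (pos {y \<in> V. f y < 4})"
    and "{p, q, r, s} \<subseteq> V" "distinct [p, q, r, s]" "{p, q} \<in> E" "{r, s} \<in> E"
    and "f p < 4" "f q < 4" "f r < 4" "f s < 4"
  shows "3 \<le> rearranged_count pos V f p q r s"
  using good_positionsD(3)[OF assms(1), of p q r s] assms(2-)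
  by (simp add: rearranged_count_def separates_by_def rearranged_def)

text \<open>As s comes after the first four, pq and rs are separated exactly when r is the last of
  p, q, r.\<close>

lemma rearranged_count_ge_2:
  assumes good: "good_positions E {y \<in> V. f y < 4} (pos {y \<in> V. f y < 4})"
    and V: "{p, q, r, s} \<subseteq> V" and "distinct [p, q, r, s]" "{p, q} \<in> E"
    and f: "f p < 4" "f q < 4" "f r < 4" "\<not> f s < 4"
  shows "2 \<le> rearranged_count pos V f p q r s"
proof -
  let ?S = "{y \<in> V. f y < 4}"
  have "separates_by (rearranged pos V f k) p q r s \<longleftrightarrow>
      pos ?S k p < pos ?S k r \<and> pos ?S k q < pos ?S k r" if "k < 6" for k
    using good_positionsD(2)[OF good that, of p] good_positionsD(2)[OF good that, of q]
      good_positionsD(2)[OF good that, of r] V f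
    by (auto simp: separates_by_def rearranged_def)
  then have "rearranged_count pos V f p q r s =
      (\<Sum>k<6. of_bool (pos ?S k p < pos ?S k r \<and> pos ?S k q < pos ?S k r))"
    unfolding rearranged_count_def by (intro sum.cong) auto
  then show ?thesis
    using good_positionsD(4)[OF good, of p q r] assms(2-) by simp
qed

text \<open>At most two endpoints are among the first four. If both belong to one edge, their mutual
  order is irrelevant. If they belong to different edges, the pair is not separated, neither before
  nor after. Hence all six orders agree with \<open>f\<close>.\<close>

lemma rearranged_count_unchanged:
  assumes good: "good_positions E {y \<in> V. f y < 4} (pos {y \<in> V. f y < 4})"
    and V: "{p, q, r, s} \<subseteq> V"
    and f: "\<not> (f p < 4 \<and> f q < 4 \<and> f r < 4)" "\<not> (f p < 4 \<and> f q < 4 \<and> f s < 4)"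
      "\<not> (f p < 4 \<and> f r < 4 \<and> f s < 4)" "\<not> (f q < 4 \<and> f r < 4 \<and> f s < 4)"
  shows "rearranged_count pos V f p q r s = 6 * of_bool (separates_by f p q r s)"
proof -
  have "separates_by (rearranged pos V f k) p q r s = separates_by f p q r s" if "k < 6" for k
  proof -
    have lt: "(rearranged pos V f k x < 4) = (f x < 4)" if "x \<in> V" for x
      using good_positionsD(2)[OF good \<open>k < 6\<close>, of x] that by (simp add: rearranged_def)
    have eq: "rearranged pos V f k x = f x" if "\<not> f x < 4" for x
      using that by (simp add: rearranged_def)
    \<comment> \<open>Only comparisons between two of the first four vertices can change.\<close>
    have mixed: "(rearranged pos V f k x < rearranged pos V f k y) = (f x < f y)"
      if "x \<in> V" "y \<in> V" "\<not> (f x < 4 \<and> f y < 4)" for x y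
      using lt[of x] lt[of y] eq[of x] eq[of y] that by linarith
    show ?thesis
      using f V mixed[of p r] mixed[of p s] mixed[of q r] mixed[of q s]
        mixed[of r p] mixed[of s p] mixed[of r q] mixed[of s q]
        lt[of p] lt[of q] lt[of r] lt[of s] eq[of p] eq[of q] eq[of r] eq[of s]
      unfolding separates_by_def
      by (cases "f p < 4"; cases "f q < 4"; cases "f r < 4"; cases "f s < 4"; simp; linarith)
  qed
  then show ?thesis unfolding rearranged_count_def by simp
qed

section \<open>Averaging over all permutations\<close>

text \<open>Without rearrangement the sum would be 6/3 = 2 per permutation. Rearranging gains at
  least 1 on average when all four endpoints come first, and loses nothing on average when exactly
  three do.\<close>

lemma sum_rearranged_count_ge:
  fixes h :: "'a \<Rightarrow> nat"
  assumes "finite V" "inj_on h V"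
    and V: "{p, q, r, s} \<subseteq> V" and dist: "distinct [p, q, r, s]"
    and E: "{p, q} \<in> E" "{r, s} \<in> E"
    and good: "\<And>\<pi>. \<pi> permutes V \<Longrightarrow>
      good_positions E {y \<in> V. (h \<circ> \<pi>) y < 4} (pos {y \<in> V. (h \<circ> \<pi>) y < 4})"
  shows "2 * card {\<pi>. \<pi> permutes V}
      + card {\<pi>. \<pi> permutes V \<and> h (\<pi> p) < 4 \<and> h (\<pi> q) < 4 \<and> h (\<pi> r) < 4 \<and> h (\<pi> s) < 4}
    \<le> (\<Sum>\<pi> | \<pi> permutes V. rearranged_count pos V (h \<circ> \<pi>) p q r s)"
proof -
  define I where "I = {\<pi>. \<pi> permutes V}"
  have finI: "finite I" unfolding I_def using \<open>finite V\<close> by (rule finite_permutations)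
  define first where "first x \<pi> \<longleftrightarrow> h (\<pi> x) < 4" for x and \<pi> :: "'a \<Rightarrow> 'a"
  define u where "u \<pi> \<longleftrightarrow> separates_by (h \<circ> \<pi>) p q r s" for \<pi>
  define w where "w \<pi> = rearranged_count pos V (h \<circ> \<pi>) p q r s" for \<pi>
  \<comment> \<open>\<open>T\<close> is the event that all four endpoints come first;
    \<open>P\<close>, \<open>Q\<close>, \<open>R\<close>, \<open>S\<close> are named after the one
    endpoint that does not.\<close>
  define T where "T \<pi> \<longleftrightarrow> first p \<pi> \<and> first q \<pi> \<and> first r \<pi> \<and> first s \<pi>" for \<pi>
  define P where "P \<pi> \<longleftrightarrow> \<not> first p \<pi> \<and> first q \<pi> \<and> first r \<pi> \<and> first s \<pi>" for \<pi>
  define Q where "Q \<pi> \<longleftrightarrow> first p \<pi> \<and> \<not> first q \<pi> \<and> first r \<pi> \<and> first s \<pi>" for \<pi>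
  define R where "R \<pi> \<longleftrightarrow> first p \<pi> \<and> first q \<pi> \<and> \<not> first r \<pi> \<and> first s \<pi>" for \<pi>
  define S where "S \<pi> \<longleftrightarrow> first p \<pi> \<and> first q \<pi> \<and> first r \<pi> \<and> \<not> first s \<pi>" for \<pi>
  note defs = T_def P_def Q_def R_def S_def
  have V': "p \<in> V" "q \<in> V" "r \<in> V" "s \<in> V" and
    dist': "p \<noteq> q" "p \<noteq> r" "p \<noteq> s" "q \<noteq> r" "q \<noteq> s" "r \<noteq> s" using V dist by auto
  have I_transpose: "\<pi> \<circ> transpose x y \<in> I" if "\<pi> \<in> I" "x \<in> V" "y \<in> V" for \<pi> x y
    using that unfolding I_def by (auto intro: permutes_compose permutes_swap_id)
  \<comment> \<open>The event \<open>X\<close> has to survive exchanging a, b, c, so the exceptional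
    endpoint is always passed as d.\<close>
  have third: "3 * card {\<pi> \<in> I. X \<pi> \<and> separates_by (h \<circ> \<pi>) a b c d} = card {\<pi> \<in> I. X \<pi>}"
    if "distinct [a, b, c, d]" "{a, b, c, d} \<subseteq> V"
      "\<And>\<pi>. X \<pi> \<Longrightarrow> X (\<pi> \<circ> transpose b c)" "\<And>\<pi>. X \<pi> \<Longrightarrow> X (\<pi> \<circ> transpose a c)"
    for X a b c d
  proof -
    have "3 * card {\<pi> \<in> {\<pi> \<in> I. X \<pi>}. separates_by (h \<circ> \<pi>) a b c d} = card {\<pi> \<in> I. X \<pi>}"
      using that I_transpose
      by (intro card_separating_third[OF assms(1,2)]) (auto simp: I_def)
    then show ?thesis by (simp add: conj_assoc)
  qed
  have "3 * card {\<pi> \<in> I. u \<pi>} = card I"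
    using third[of p q r s "\<lambda>_. True"] V' dist' by (simp add: u_def)
  moreover have "3 * card {\<pi> \<in> I. T \<pi> \<and> u \<pi>} = card {\<pi> \<in> I. T \<pi>}"
    using third[of p q r s T] V' dist' by (simp add: u_def defs first_def)
  moreover have "3 * card {\<pi> \<in> I. S \<pi> \<and> u \<pi>} = card {\<pi> \<in> I. S \<pi>}"
    using third[of p q r s S] V' dist' by (simp add: u_def defs first_def)
  moreover have "3 * card {\<pi> \<in> I. R \<pi> \<and> u \<pi>} = card {\<pi> \<in> I. R \<pi>}"
    using third[of p q s r R] V' dist'
    by (simp add: u_def defs first_def separates_by_commute(1)[of _ p q s r])
  moreover have "3 * card {\<pi> \<in> I. Q \<pi> \<and> u \<pi>} = card {\<pi> \<in> I. Q \<pi>}"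
    using third[of r s p q Q] V' dist'
    by (simp add: u_def defs first_def separates_by_commute(2)[of _ r s p q])
  moreover have "3 * card {\<pi> \<in> I. P \<pi> \<and> u \<pi>} = card {\<pi> \<in> I. P \<pi>}"
    using third[of r s q p P] V' dist'
    by (simp add: u_def defs first_def separates_by_commute(2)[of _ r s p q] separates_by_commute(1)[of _ r s q p])
  \<comment> \<open>On the five events the old contribution 6 or 0 is replaced by the lower bound 3
    or 2. The removed terms stand on the right to avoid subtraction of naturals.\<close>
  moreover have "6 * card {\<pi> \<in> I. u \<pi>} + 3 * card {\<pi> \<in> I. T \<pi>} + 2 * card {\<pi> \<in> I. S \<pi>}
      + 2 * card {\<pi> \<in> I. R \<pi>} + 2 * card {\<pi> \<in> I. Q \<pi>} + 2 * card {\<pi> \<in> I. P \<pi>}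
    \<le> (\<Sum>\<pi>\<in>I. w \<pi>) + 6 * card {\<pi> \<in> I. T \<pi> \<and> u \<pi>} + 6 * card {\<pi> \<in> I. S \<pi> \<and> u \<pi>}
      + 6 * card {\<pi> \<in> I. R \<pi> \<and> u \<pi>} + 6 * card {\<pi> \<in> I. Q \<pi> \<and> u \<pi>} + 6 * card {\<pi> \<in> I. P \<pi> \<and> u \<pi>}"
  proof -
    have card_eq: "card {\<pi> \<in> I. X \<pi>} = (\<Sum>\<pi>\<in>I. of_bool (X \<pi>))" for X
      using finI by (simp add: sum_of_bool_eq Int_def)
    have ptw: "6 * of_bool (u \<pi>) + 3 * of_bool (T \<pi>) + 2 * of_bool (S \<pi>)
        + 2 * of_bool (R \<pi>) + 2 * of_bool (Q \<pi>) + 2 * of_bool (P \<pi>)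
      \<le> w \<pi> + 6 * of_bool (T \<pi> \<and> u \<pi>) + 6 * of_bool (S \<pi> \<and> u \<pi>)
        + 6 * of_bool (R \<pi> \<and> u \<pi>) + 6 * of_bool (Q \<pi> \<and> u \<pi>) + 6 * of_bool (P \<pi> \<and> u \<pi>)"
      if "\<pi> \<in> I" for \<pi>
    proof -
      let ?f = "h \<circ> \<pi>"
      note g = good[of \<pi>, OF that[unfolded I_def mem_Collect_eq]]
      note ge3 = rearranged_count_ge_3[where f = ?f and V = V and pos = pos and E = E]
        and ge2 = rearranged_count_ge_2[where f = ?f and V = V and pos = pos and E = E]
        and unchanged = rearranged_count_unchanged[where f = ?f and V = V and pos = pos and E = E]
      have wT: "3 \<le> w \<pi>" if "T \<pi>"
        using that ge3[OF g V dist E] by (simp add: w_def defs first_def)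
      have wS: "2 \<le> w \<pi>" if "S \<pi>"
        using that ge2[OF g V dist E(1)] by (simp add: w_def defs first_def)
      have wR: "2 \<le> w \<pi>" if "R \<pi>"
        using that ge2[OF g, of p q s r] V' dist' E
        by (simp add: w_def defs first_def rearranged_count_commute(1)[of _ _ _ p q s r])
      have wQ: "2 \<le> w \<pi>" if "Q \<pi>"
        using that ge2[OF g, of r s p q] V' dist' E
        by (simp add: w_def defs first_def rearranged_count_commute(2)[of _ _ _ r s p q])
      have wP: "2 \<le> w \<pi>" if "P \<pi>"
        using that ge2[OF g, of r s q p] V' dist' E
        by (simp add: w_def defs first_def rearranged_count_commute(2)[of _ _ _ r s p q]
            rearranged_count_commute(1)[of _ _ _ r s q p])
      have w0: "w \<pi> = 6 * of_bool (u \<pi>)" if "\<not> T \<pi>" "\<not> S \<pi>" "\<not> R \<pi>" "\<not> Q \<pi>" "\<not> P \<pi>"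
        unfolding w_def u_def using that
        by (intro unchanged[OF g V]) (auto simp: defs first_def)
      consider "T \<pi> \<and> \<not> S \<pi> \<and> \<not> R \<pi> \<and> \<not> Q \<pi> \<and> \<not> P \<pi>"
        | "\<not> T \<pi> \<and> S \<pi> \<and> \<not> R \<pi> \<and> \<not> Q \<pi> \<and> \<not> P \<pi>"
        | "\<not> T \<pi> \<and> \<not> S \<pi> \<and> R \<pi> \<and> \<not> Q \<pi> \<and> \<not> P \<pi>"
        | "\<not> T \<pi> \<and> \<not> S \<pi> \<and> \<not> R \<pi> \<and> Q \<pi> \<and> \<not> P \<pi>"
        | "\<not> T \<pi> \<and> \<not> S \<pi> \<and> \<not> R \<pi> \<and> \<not> Q \<pi> \<and> P \<pi>"
        | "\<not> T \<pi> \<and> \<not> S \<pi> \<and> \<not> R \<pi> \<and> \<not> Q \<pi> \<and> \<not> P \<pi>"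
        unfolding defs by blast
      then show ?thesis
        by cases (use wT wS wR wQ wP w0 in simp_all)
    qed
    show ?thesis
      unfolding card_eq sum_distrib_left sum.distrib[symmetric] using ptw by (rule sum_mono)
  qed
  \<comment> \<open>By the one-third identities the terms for \<open>P\<close>, \<open>Q\<close>,
    \<open>R\<close>, \<open>S\<close> cancel, and \<open>T\<close> retains 3 - 2 = 1.\<close>
  ultimately have "2 * card I + card {\<pi> \<in> I. T \<pi>} \<le> (\<Sum>\<pi>\<in>I. w \<pi>)" by linarith
  then show ?thesis unfolding I_def w_def T_def first_def by simp
qed

text \<open>Division by 6C times the number of permutations, with C the binomial coefficient, gives
  the probability bound 1/3 + 1/(6C); the product form stays within the naturals.\<close>

lemma card_rearranged_separating_ge:
  fixes h :: "'a \<Rightarrow> nat"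
  assumes "finite V" "bij_betw h V {0..<card V}" "4 \<le> card V"
    and V: "{p, q, r, s} \<subseteq> V" and dist: "distinct [p, q, r, s]"
    and E: "{p, q} \<in> E" "{r, s} \<in> E"
    and good: "\<And>\<pi>. \<pi> permutes V \<Longrightarrow>
      good_positions E {y \<in> V. (h \<circ> \<pi>) y < 4} (pos {y \<in> V. (h \<circ> \<pi>) y < 4})"
  shows "(2 * (card V choose 4) + 1) * card {\<pi>. \<pi> permutes V} \<le> (card V choose 4) *
    card {i \<in> {\<pi>. \<pi> permutes V} \<times> {..<6}. separates_by (rearranged pos V (h \<circ> fst i) (snd i)) p q r s}"
proof -
  define I where "I = {\<pi>. \<pi> permutes V}"
  define T where "T = {p, q, r, s}"
  define F where "F = {v \<in> V. h v < 4}"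
  have finI: "finite I" unfolding I_def using \<open>finite V\<close> by (rule finite_permutations)
  have inj: "inj_on h V" using assms(2) by (rule bij_betw_imp_inj_on)
  have cT: "card T = 4" using dist by (simp add: T_def)
  \<comment> \<open>As \<open>h\<close> takes all values below \<open>card V\<close>, exactly four
    vertices have position below 4.\<close>
  have "h ` F = {0..<4}"
  proof -
    have "h ` V = {0..<card V}" using assms(2) by (rule bij_betw_imp_surj_on)
    then have "{0..<4} \<subseteq> h ` V" using \<open>4 \<le> card V\<close> by simp
    then show ?thesis unfolding F_def by force
  qed
  then have cF: "card F = 4"
    using card_image[OF inj_on_subset[OF inj, of F]] by (simp add: F_def)
  have "{\<pi>. \<pi> permutes V \<and> \<pi> ` T = F}
      \<subseteq> {\<pi>. \<pi> permutes V \<and> h (\<pi> p) < 4 \<and> h (\<pi> q) < 4 \<and> h (\<pi> r) < 4 \<and> h (\<pi> s) < 4}"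
    unfolding T_def F_def by auto
  then have "card {\<pi>. \<pi> permutes V \<and> \<pi> ` T = F}
      \<le> card {\<pi>. \<pi> permutes V \<and> h (\<pi> p) < 4 \<and> h (\<pi> q) < 4 \<and> h (\<pi> r) < 4 \<and> h (\<pi> s) < 4}"
    by (rule card_mono[rotated]) (rule finite_subset[OF _ finI], auto simp: I_def)
  then have "2 * card I + card {\<pi>. \<pi> permutes V \<and> \<pi> ` T = F}
      \<le> (\<Sum>\<pi>\<in>I. rearranged_count pos V (h \<circ> \<pi>) p q r s)"
    using sum_rearranged_count_ge[OF \<open>finite V\<close> inj V dist E, of pos] good
    unfolding I_def by fastforce
  also have "\<dots> = (\<Sum>i\<in>I \<times> {..<6}. of_bool (separates_by (rearranged pos V (h \<circ> fst i) (snd i)) p q r s))"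
    unfolding rearranged_count_def sum.cartesian_product by (simp only: case_prod_unfold)
  also have "\<dots> = card {i \<in> I \<times> {..<6}. separates_by (rearranged pos V (h \<circ> fst i) (snd i)) p q r s}"
    using finI by (simp add: sum_of_bool_eq Int_def)
  finally have "(card V choose 4) * (2 * card I + card {\<pi>. \<pi> permutes V \<and> \<pi> ` T = F})
      \<le> (card V choose 4) * card {i \<in> I \<times> {..<6}. separates_by (rearranged pos V (h \<circ> fst i) (snd i)) p q r s}"
    by (rule mult_le_mono2)
  moreover have "(card V choose 4) * card {\<pi>. \<pi> permutes V \<and> \<pi> ` T = F} = card I"
    using binomial_mult_card_permutes_image_eq[OF \<open>finite V\<close>, of T F] V cT cF
    unfolding I_def by (auto simp: T_def F_def)
  ultimately show ?thesis
    unfolding I_def by (simp add: algebra_simps)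
qed

section \<open>The explicit bound for graphs without a complete subgraph on four vertices\<close>

lemma nonincident_edges_obtain:
  assumes "simple_graph V E" "e \<in> E" "f \<in> E" "nonincident e f"
  obtains p q r s where "e = {p, q}" "f = {r, s}" "distinct [p, q, r, s]" "{p, q, r, s} \<subseteq> V"
proof -
  from assms obtain p q r s where "e = {p, q}" "p \<noteq> q" "f = {r, s}" "r \<noteq> s"
    unfolding simple_graph_def by (metis card_2_iff)
  with assms show ?thesis
    by (intro that[of p q r s]) (auto simp: nonincident_def simple_graph_def)
qed

text \<open>Fewer than four vertices make the binomial coefficient 0; as 1/0 = 0, the bound is then 3.\<close>

lemma frac_sep_dim_le_if_K4_free:
  assumes G: "simple_graph V E" and K4: "\<not> contains_complete 4 V E"
  shows "frac_sep_dim V E \<le> ereal (3 / (1 + 1 / (2 * real (card V choose 4))))"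
proof (cases "4 \<le> card V")
  case False
  have fin: "finite V" using G by (simp add: simple_graph_def)
  have "\<not> nonincident e f" if "e \<in> E" "f \<in> E" for e f
  proof
    assume "nonincident e f"
    with G that obtain p q r s where "distinct [p, q, r, s]" "{p, q, r, s} \<subseteq> V"
      by (rule nonincident_edges_obtain)
    then have "4 \<le> card V" using card_mono[OF fin, of "{p, q, r, s}"] by simp
    with False show False by simp
  qed
  \<comment> \<open>With no nonincident pair at all, the empty family already works and gives the
    bound 0.\<close>
  then have "frac_sep_dim V E \<le> ereal (real (card ({} :: unit set)) / real 1)"
    by (intro frac_sep_dim_le_of_family) auto
  also have "\<dots> \<le> ereal (3 / (1 + 1 / (2 * real (card V choose 4))))"
    by simp
  finally show ?thesis .
next
  case True
  define C where "C = card V choose 4"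
  have "C > 0" using True by (simp add: C_def)
  have fin: "finite V" using G by (simp add: simple_graph_def)
  obtain h where h: "bij_betw h V {0..<card V}"
    using ex_bij_betw_finite_nat[OF fin] by blast
  have inj: "inj_on h V" using h by (rule bij_betw_imp_inj_on)
  have "\<exists>pos. good_positions E S pos" if "S \<subseteq> V" "card S = 4" for S
  proof -
    have "finite S" using that fin finite_subset by blast
    with K4 that obtain u v where "u \<in> S" "v \<in> S" "u \<noteq> v" "{u, v} \<notin> E"
      unfolding contains_complete_def by blast
    with \<open>card S = 4\<close> show ?thesis by (rule ex_good_positions)
  qed
  then obtain pos where pos: "good_positions E S (pos S)" if "S \<subseteq> V" "card S = 4" for S
    by metis
  have inj_h: "inj_on (h \<circ> \<pi>) V" and good: "good_positions E {y \<in> V. (h \<circ> \<pi>) y < 4} (pos {y \<in> V. (h \<circ> \<pi>) y < 4})"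
    if "\<pi> permutes V" for \<pi>
  proof -
    show inj': "inj_on (h \<circ> \<pi>) V"
      using inj that by (simp add: comp_inj_on permutes_inj_on permutes_image)
    let ?S = "{y \<in> V. (h \<circ> \<pi>) y < 4}"
    have "(h \<circ> \<pi>) ` V = {0..<card V}"
      using bij_betw_imp_surj_on[OF h] permutes_image[OF that] by (simp only: image_comp[symmetric])
    then have "{0..<4} \<subseteq> (h \<circ> \<pi>) ` V" using True by simp
    then have "(h \<circ> \<pi>) ` ?S = {0..<4}" by force
    then have "card ?S = 4"
      using card_image[OF inj_on_subset[OF inj', of ?S]] by simp
    then show "good_positions E ?S (pos ?S)" by (intro pos) auto
  qed
  define N where "N = card {\<pi>. \<pi> permutes V}"
  have "N > 0" using fin by (simp add: N_def card_permutations)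
  \<comment> \<open>The last coordinate is ignored by \<open>r\<close>: each ordering is repeated
    \<open>C\<close> times, which turns the lower bound (2C+1)N/C into an integer.\<close>
  define I where "I = ({\<pi>. \<pi> permutes V} \<times> {..<6::nat}) \<times> {..<C}"
  define r where "r i = position_order V (rearranged pos V (h \<circ> fst (fst i)) (snd (fst i)))"
    for i :: "(('a \<Rightarrow> 'a) \<times> nat) \<times> nat"
  have "frac_sep_dim V E \<le> ereal (real (card I) / real ((2 * C + 1) * N))"
  proof (rule frac_sep_dim_le_of_family)
    show "finite I" unfolding I_def using finite_permutations[OF fin] by simp
    show "(2 * C + 1) * N > 0" using \<open>N > 0\<close> by simp
    show "linear_order_on V (r i)" if "i \<in> I" for i
      using that unfolding I_def r_def
      by (auto intro!: linear_order_on_position_order inj_on_rearranged inj_h good)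
  next
    fix e f assume "e \<in> E" "f \<in> E" "nonincident e f"
    then obtain p q u v where e: "e = {p, q}" "f = {u, v}" and
      pq: "distinct [p, q, u, v]" "{p, q, u, v} \<subseteq> V"
      using G by (metis nonincident_edges_obtain)
    let ?A = "{i \<in> {\<pi>. \<pi> permutes V} \<times> {..<6}. separates_by (rearranged pos V (h \<circ> fst i) (snd i)) p q u v}"
    have "(2 * C + 1) * N \<le> C * card ?A"
      unfolding C_def N_def
      using \<open>e \<in> E\<close> \<open>f \<in> E\<close> e pq good by (intro card_rearranged_separating_ge[OF fin h True]) auto
    also have "\<dots> = card (?A \<times> {..<C})" by (simp add: card_cartesian_product)
    also have "\<dots> \<le> card {i \<in> I. separates (r i) e f}"
    proof (rule card_mono)
      show "finite {i \<in> I. separates (r i) e f}"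
        unfolding I_def using finite_permutations[OF fin] by simp
      show "?A \<times> {..<C} \<subseteq> {i \<in> I. separates (r i) e f}"
        unfolding I_def r_def e using separates_position_order[OF _ pq(2)] by auto
    qed
    finally show "(2 * C + 1) * N \<le> card {i \<in> I. separates (r i) e f}" .
  qed
  also have "real (card I) / real ((2 * C + 1) * N) = 3 / (1 + 1 / (2 * real C))"
  proof -
    have "real (card I) = 6 * real C * real N"
      by (simp add: I_def card_cartesian_product N_def[symmetric])
    moreover have "real ((2 * C + 1) * N) = (2 * real C + 1) * real N"
      by (simp add: algebra_simps)
    moreover have "1 + 1 / (2 * real C) = (2 * real C + 1) / (2 * real C)"
      using \<open>C > 0\<close> by (simp add: field_simps)
    ultimately show ?thesis using \<open>N > 0\<close> by simp
  qed
  finally show ?thesis unfolding C_def .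
qed

section \<open>Asymptotics\<close>

text \<open>Subtraction is in the reals, so the formula also covers n < 4, where both sides vanish.
  The explicit polynomial makes the asymptotic expansion computable.\<close>

lemma of_nat_choose_4:
  "real (n choose 4) = real n * (real n - 1) * (real n - 2) * (real n - 3) / 24"
  by (simp add: binomial_gbinomial gbinomial_prod_rev numeral_eq_Suc fact_numeral)

theorem mainTheorem2:
  shows "\<exists>err :: nat \<Rightarrow> real. err \<in> O(\<lambda>n. 1 / real n ^ 5) \<and>
    (\<forall>(n :: nat) (V :: 'a set) E. simple_graph V E \<longrightarrow> card V = n \<longrightarrow> \<not> contains_complete 4 V E \<longrightarrow>
       frac_sep_dim V E \<le> ereal (3 * (1 - 12 / real n ^ 4 + err n)))"
proof -
  \<comment> \<open>The exact remainder, depending on n alone and hence uniform over all graphs.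
    Since the binomial coefficient is n^4/24 + O(n^3), 1/(2C) is 12/n^4 + O(1/n^5), and the
    quadratic term is only O(1/n^8).\<close>
  define err where "err n = 1 / (1 + 1 / (2 * real (n choose 4))) - 1 + 12 / real n ^ 4" for n :: nat
  have "err \<in> O(\<lambda>n. 1 / real n ^ 5)"
    unfolding err_def of_nat_choose_4 by real_asymp
  moreover have "3 * (1 - 12 / real n ^ 4 + err n) = 3 / (1 + 1 / (2 * real (n choose 4)))" for n
    by (simp add: err_def)
  ultimately show ?thesis
    using frac_sep_dim_le_if_K4_free by (intro exI[of _ err]) auto
qed

end
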